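(* For any $\epsilon,R\ge0$ (and any $k,n\in\mathbb{N}$) there exist $(\epsilon,R)$-LDP mechanisms $Q_1,\dots,Q_n$ and an estimator $\hat{\mathbf{p}}$ such that $$\sup_{\mathbf{p}\in\Delta_k}\mathbb{E}\big[\|\hat{\mathbf{p}}(Y^n)-\mathbf{p}\|_2^2\big]\;\le\;\eta:=\begin{cases}\dfrac{2k(e^{\epsilon}+1)^2}{n(e^{\epsilon}-1)^2}&\text{if }R\ge H_2\!\left(\frac{e^{\epsilon}}{e^{\epsilon}+1}\right),\\[2ex]\dfrac{2k\,e^{2\epsilon}}{n\,p_R^2\,(e^{\epsilon}-1)^2}&\text{if }R<H_2\!\left(\frac{e^{\epsilon}}{e^{\epsilon}+1}\right),\end{cases}$$ where $p_R\le 0.5$ is given by $p_R=H_2^{-1}(R)$; and the error under the $\ell_1$ loss satisfies $\sup_{\mathbf{p}\in\Delta_k}\mathbb{E}\big[\|\hat{\mathbf{p}}(Y^n)-\mathbf{p}\|_1\big]\le\sqrt{k\eta}$.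
   Context: Entropies are in bits. $H_2(p)=-p\log p-(1-p)\log(1-p)$ is the binary entropy. Let $\mathcal{X}=[k]=\{1,\dots,k\}$. A mechanism $Q$ is a conditional distribution $Q(y|x)$ from $\mathcal{X}$ to a finite output alphabet $\mathcal{Y}$. It is $(\epsilon,R)$-LDP if $\sup_{y\in\mathcal{Y}} Q(y|x)/Q(y|x')\le e^{\epsilon}$ for all $x,x'\in\mathcal{X}$, and $H(Y|X=x)=\sum_y Q(y|x)\log\frac1{Q(y|x)}\le R$ for all $x\in\mathcal{X}$. There are $n$ users; user $i$ holds $X_i$, with $X_1,\dots,X_n$ i.i.d. from an unknown $\mathbf{p}\in\Delta_k$ (the probability simplex over $[k]$), and outputs $Y_i$ by applying $Q_i$ to $X_i$, using private randomness independent across users. Write $Y^n=[Y_1,\dots,Y_n]$. An estimator is a function $\hat{\mathbf{p}}$ mapping $Y^n$ to $\mathbb{R}^k$. *)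

theory Defs
  imports "HOL-Probability.Probability"
begin

text \<open>
  The input alphabet \<open>[k]\<close> is a finite type \<open>'k\<close> with \<open>k = CARD('k)\<close>; users are indexed by
  \<open>{1..n}\<close>; entropies are in bits.
\<close>

definition H2 :: "real \<Rightarrow> real" where
  "H2 p = - p * log 2 p - (1 - p) * log 2 (1 - p)"

text \<open>The inverse of \<open>H2\<close> on \<open>[0, 1/2]\<close>; only meaningful on \<open>[0, 1]\<close>.\<close>

definition H2_inv :: "real \<Rightarrow> real" where
  "H2_inv = the_inv_into {0..1/2} H2"

definition cond_entropy_at :: "'y set \<Rightarrow> ('x \<Rightarrow> 'y pmf) \<Rightarrow> 'x \<Rightarrow> real" where
  "cond_entropy_at Y Q x = (\<Sum>y\<in>Y. pmf (Q x) y * log 2 (1 / pmf (Q x) y))"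

definition mechanism :: "'y set \<Rightarrow> ('x \<Rightarrow> 'y pmf) \<Rightarrow> bool" where
  "mechanism Y Q \<longleftrightarrow> finite Y \<and> (\<forall>x. set_pmf (Q x) \<subseteq> Y)"

text \<open>
  The likelihood ratios are taken in \<^typ>\<open>ennreal\<close>, where \<open>a / 0 = \<infinity>\<close> for \<open>a > 0\<close> and \<open>0 / 0 = 0\<close>:
  real division would make a zero denominator satisfy the privacy constraint for free.
\<close>

definition LDP :: "real \<Rightarrow> real \<Rightarrow> 'y set \<Rightarrow> ('x \<Rightarrow> 'y pmf) \<Rightarrow> bool" where
  "LDP \<epsilon> R Y Q \<longleftrightarrow>
     mechanism Y Q \<and>
     (\<forall>x x'. (SUP y\<in>Y. ennreal (pmf (Q x) y) / ennreal (pmf (Q x') y)) \<le> ennreal (exp \<epsilon>)) \<and>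
     (\<forall>x. cond_entropy_at Y Q x \<le> R)"

definition prob_simplex :: "(real ^ 'k) set" where
  "prob_simplex = {p. (\<forall>x. 0 \<le> p $ x) \<and> (\<Sum>x\<in>UNIV. p $ x) = 1}"

definition simplex_pmf :: "real ^ 'k \<Rightarrow> 'k pmf" where
  "simplex_pmf p = embed_pmf (\<lambda>x. p $ x)"

lemma pmf_simplex_pmf:
  assumes "p \<in> prob_simplex"
  shows "pmf (simplex_pmf p) x = p $ x"
proof -
  have "(\<integral>\<^sup>+x. ennreal (p $ x) \<partial>count_space UNIV) = ennreal (\<Sum>x\<in>UNIV. p $ x)"
    using assms by (simp add: nn_integral_count_space_finite prob_simplex_def)
  then show ?thesis
    using assms by (simp add: simplex_pmf_def pmf_embed_pmf prob_simplex_def)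
qed

text \<open>
  The law of \<open>Y\<^sup>n\<close>, as a function that is \<open>undefined\<close> outside \<open>{1..n}\<close>: first \<open>X\<^sup>n\<close> is drawn
  i.i.d. from \<open>p\<close>, then each \<open>Y i\<close> independently from \<open>Q i (X i)\<close>.
\<close>

definition output_law :: "nat \<Rightarrow> (nat \<Rightarrow> 'k \<Rightarrow> 'y pmf) \<Rightarrow> real ^ 'k \<Rightarrow> (nat \<Rightarrow> 'y) pmf" where
  "output_law n Q p =
     bind_pmf (Pi_pmf {1..n} undefined (\<lambda>_. simplex_pmf p))
       (\<lambda>X. Pi_pmf {1..n} undefined (\<lambda>i. Q i (X i)))"

definition l1_norm :: "real ^ 'k \<Rightarrow> real" where
  "l1_norm v = (\<Sum>x\<in>UNIV. \<bar>v $ x\<bar>)"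

definition l2_risk ::
    "nat \<Rightarrow> (nat \<Rightarrow> 'k \<Rightarrow> 'y pmf) \<Rightarrow> ((nat \<Rightarrow> 'y) \<Rightarrow> real ^ 'k) \<Rightarrow> real ^ 'k \<Rightarrow> ennreal" where
  "l2_risk n Q est p =
     (\<integral>\<^sup>+ y. ennreal ((norm (est y - p))\<^sup>2) \<partial>measure_pmf (output_law n Q p))"

definition l1_risk ::
    "nat \<Rightarrow> (nat \<Rightarrow> 'k \<Rightarrow> 'y pmf) \<Rightarrow> ((nat \<Rightarrow> 'y) \<Rightarrow> real ^ 'k) \<Rightarrow> real ^ 'k \<Rightarrow> ennreal" where
  "l1_risk n Q est p =
     (\<integral>\<^sup>+ y. ennreal (l1_norm (est y - p)) \<partial>measure_pmf (output_law n Q p))"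

text \<open>
  The denominators vanish exactly when \<open>n = 0\<close>, \<open>\<epsilon> = 0\<close> or (in the second case) \<open>R = 0\<close>;
  division in \<^typ>\<open>ennreal\<close> then gives \<open>\<infinity>\<close>.
\<close>

definition eta :: "real \<Rightarrow> real \<Rightarrow> nat \<Rightarrow> nat \<Rightarrow> ennreal" where
  "eta \<epsilon> R k n =
     (if R \<ge> H2 (exp \<epsilon> / (exp \<epsilon> + 1))
      then ennreal (2 * real k * (exp \<epsilon> + 1)\<^sup>2) / ennreal (real n * (exp \<epsilon> - 1)\<^sup>2)
      else ennreal (2 * real k * exp (2 * \<epsilon>)) /
             ennreal (real n * (H2_inv R)\<^sup>2 * (exp \<epsilon> - 1)\<^sup>2))"

definition ennreal_sqrt :: "ennreal \<Rightarrow> ennreal" where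
  "ennreal_sqrt a = (if a = \<infinity> then \<infinity> else ennreal (sqrt (enn2real a)))"

end

theory Submission
  imports Defs "HOL-Real_Asymp.Real_Asymp"
begin

text \<open>
  User \<open>i\<close> reports one bit that equals 1 with probability \<open>a + b * g i x\<close>, where the sign
  vectors \<open>g i\<close> run cyclically through the rows of a Sylvester-Hadamard matrix of order
  \<open>K \<in> [k, 2k]\<close>, truncated to \<open>k\<close> columns. Orthogonality of the columns makes the linear
  estimator unbiased over the first \<open>m = \<lfloor>n/K\<rfloor> K \<ge> n/2\<close> users, and since a bit has variance at
  most \<open>1/4\<close> its squared error is at most \<open>k / (4 m b\<^sup>2) \<le> 2 k / (n (2b)\<^sup>2)\<close>. If \<open>n < 2k\<close>, this
  bound exceeds 1 and the zero estimator suffices. For large \<open>R\<close> take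
  \<open>a \<plusminus> b = e\<^sup>\<epsilon> / (e\<^sup>\<epsilon> + 1), 1 / (e\<^sup>\<epsilon> + 1)\<close> (randomised response); for small \<open>R\<close> take
  \<open>a + b = p\<^sub>R\<close> and \<open>a - b = e\<^sup>-\<^sup>\<epsilon> p\<^sub>R\<close>, whose entropies are at most \<open>R\<close> by monotonicity of \<open>H2\<close> on
  \<open>[0, 1/2]\<close>. The \<open>\<ell>\<^sub>1\<close> bound follows by Cauchy-Schwarz.
\<close>

section \<open>Sylvester-Hadamard matrices and sign designs\<close>

text \<open>Orthogonality survives the Kronecker product with the 2 by 2 matrix with rows
  \<open>(1, 1)\<close> and \<open>(1, -1)\<close>, so the order can be doubled repeatedly.\<close>

lemma sylvester_hadamard:
  "\<exists>h :: nat \<Rightarrow> nat \<Rightarrow> real. (\<forall>i x. h i x \<in> {-1, 1}) \<and>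
     (\<forall>x<2^r. \<forall>x'<2^r. (\<Sum>i<2^r. h i x * h i x') = (if x = x' then 2^r else 0))"
proof (induction r)
  case 0
  show ?case by (rule exI[of _ "\<lambda>_ _. 1"]) auto
next
  case (Suc r)
  then obtain h :: "nat \<Rightarrow> nat \<Rightarrow> real" where h: "\<And>i x. h i x \<in> {-1, 1}"
    and orth: "\<And>x x'. x < 2^r \<Longrightarrow> x' < 2^r \<Longrightarrow>
      (\<Sum>i<2^r. h i x * h i x') = (if x = x' then 2^r else 0)"
    by metis
  \<comment> \<open>The low bits of \<open>i\<close> and \<open>x\<close> index the 2 by 2 factor,
    the remaining bits index \<open>h\<close>.\<close>
  define h' where "h' i x = h (i div 2) (x div 2) * (if odd i \<and> odd x then -1 else 1)" for i x
  have split: "(\<Sum>i<2 * N. f i) = (\<Sum>i<N. f (2 * i) + f (2 * i + 1))"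
    for N :: nat and f :: "nat \<Rightarrow> real"
    by (induction N) auto
  have "h' i x \<in> {-1, 1}" for i x
    using h[of "i div 2" "x div 2"] by (auto simp: h'_def)
  moreover have "(\<Sum>i<2^Suc r. h' i x * h' i x') = (if x = x' then 2^Suc r else 0)"
    if "x < 2^Suc r" "x' < 2^Suc r" for x x'
  proof -
    \<comment> \<open>\<open>c\<close> is the inner product of the columns of the 2 by 2 factor
      selected by the parities of \<open>x\<close> and \<open>x'\<close>.\<close>
    define c :: real where "c = (if odd x = odd x' then 2 else 0)"
    have "(\<Sum>i<2^Suc r. h' i x * h' i x')
        = (\<Sum>i<2^r. c * (h i (x div 2) * h i (x' div 2)))"
      unfolding power_Suc split by (intro sum.cong) (auto simp: h'_def c_def)
    also have "\<dots> = c * (if x div 2 = x' div 2 then 2^r else 0)"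
      unfolding sum_distrib_left[symmetric] using that by (subst orth) auto
    also have "\<dots> = (if x = x' then 2^Suc r else 0)"
    proof (cases "odd x = odd x' \<and> x div 2 = x' div 2")
      case True
      then have "x = x'" by (metis bit_eq_rec odd_iff_mod_2_eq_one)
      then show ?thesis by (simp add: c_def)
    next
      case False
      then show ?thesis by (auto simp: c_def)
    qed
    finally show ?thesis .
  qed
  ultimately show ?case by blast
qed

text \<open>The range splits into \<open>q\<close> full periods of length \<open>K\<close>. The
  shift by 1 is there because users are numbered from 1 but matrix rows from 0.\<close>

lemma sum_periodic:
  fixes f :: "nat \<Rightarrow> real"
  shows "(\<Sum>i\<in>{1..q * K}. f ((i - 1) mod K)) = real q * (\<Sum>j<K. f j)"
proof -
  have "(\<Sum>i\<in>{1..q * K}. f ((i - 1) mod K)) = (\<Sum>i<q * K. f (i mod K))"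
    by (rule sum.reindex_bij_witness[of _ Suc "\<lambda>i. i - 1"])
       (auto simp del: mult_Suc simp: less_Suc_eq_le Suc_le_eq)
  also have "\<dots> = (\<Sum>m<q. sum (\<lambda>i. f (i mod K)) {m * K..<m * K + K})"
    by (rule sum.nat_group[symmetric])
  also have "\<dots> = (\<Sum>m<q. \<Sum>j<K. f j)"
  proof (rule sum.cong[OF refl])
    fix m
    have mod: "i mod K = i - m * K" if "m * K \<le> i" "i < m * K + K" for i
      using that by (intro mod_nat_eqI) auto
    show "sum (\<lambda>i. f (i mod K)) {m * K..<m * K + K} = (\<Sum>j<K. f j)"
      by (rule sum.reindex_bij_witness[of _ "\<lambda>j. j + m * K" "\<lambda>i. i - m * K"])
         (auto simp: mod)
  qed
  finally show ?thesis by simp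
qed

lemma orthogonal_sign_design:
  assumes "2 * CARD('k::finite) \<le> n"
  obtains m and g :: "nat \<Rightarrow> 'k::finite \<Rightarrow> real" where
    "0 < m" "m \<le> n" "n \<le> 2 * m" "\<And>i x. g i x \<in> {-1, 1}"
    "\<And>x x'. (\<Sum>i\<in>{1..m}. g i x * g i x') = (if x = x' then real m else 0)"
proof -
  define k where "k = CARD('k)"
  have "k \<ge> 1" by (simp add: k_def Suc_leI)
  then obtain r where r: "2^r \<le> k" "k < 2^(r+1)"
    using ex_power_ivl1[of 2 k] by auto
  \<comment> \<open>Doubling the largest power of two below or equal to \<open>k\<close> gives
    \<open>k < K\<close> and \<open>K \<le> 2 * k \<le> n\<close>, so at least one full period of
    users exists.\<close>
  define K :: nat where "K = 2^(r+1)"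
  have K: "k \<le> K" "K \<le> n" "K > 0"
    using r assms by (auto simp: K_def k_def)
  obtain h :: "nat \<Rightarrow> nat \<Rightarrow> real" where h: "\<And>i x. h i x \<in> {-1, 1}"
    and orth: "\<And>x x'. x < K \<Longrightarrow> x' < K \<Longrightarrow>
      (\<Sum>i<K. h i x * h i x') = (if x = x' then real K else 0)"
    using sylvester_hadamard[of "r+1"] unfolding K_def by (metis of_nat_numeral of_nat_power)
  obtain e :: "'k \<Rightarrow> nat" where e: "bij_betw e UNIV {0..<k}"
    using ex_bij_betw_finite_nat[of "UNIV :: 'k set"] by (auto simp: k_def)
  have eK: "e x < K" for x
    using e K by (auto simp: bij_betw_def) (metis atLeastLessThan_iff order_less_le_trans rangeI)
  have inj: "e x = e x' \<longleftrightarrow> x = x'" for x x'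
    using e by (auto simp: bij_betw_def inj_on_def)
  define q where "q = n div K"
  have q: "q > 0" using K by (simp add: q_def div_greater_zero_iff)
  have n: "n = q * K + n mod K" by (simp add: q_def)
  \<comment> \<open>The users left over number fewer than one period, hence fewer than those
    retained.\<close>
  have "n mod K < K" using K by simp
  also have "K \<le> q * K" using q by simp
  finally have n2: "n \<le> 2 * (q * K)" using n by linarith
  show ?thesis
  proof (rule that[of "q * K" "\<lambda>i x. h ((i - 1) mod K) (e x)"])
    show "0 < q * K" "q * K \<le> n" "n \<le> 2 * (q * K)"
      using q K n n2 by (simp, linarith, simp)
    show "h ((i - 1) mod K) (e x) \<in> {-1, 1}" for i x by (rule h)
    show "(\<Sum>i\<in>{1..q * K}. h ((i - 1) mod K) (e x) * h ((i - 1) mod K) (e x'))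
        = (if x = x' then real (q * K) else 0)" for x x'
      using sum_periodic[of "\<lambda>i. h i (e x) * h i (e x')" K q] orth[OF eK eK, of x x']
      by (simp add: inj)
  qed
qed

section \<open>Second moments of independent sums\<close>

text \<open>After expanding the square, the off-diagonal expectations factor by independence and
  vanish because the variables are centred.\<close>

lemma (in prob_space) second_moment_indep_sum:
  fixes X :: "'i \<Rightarrow> 'a \<Rightarrow> real"
  assumes "finite A" and ind: "indep_vars (\<lambda>_. borel) X A"
    and int: "\<And>i. i \<in> A \<Longrightarrow> integrable M (X i)"
    and int2: "\<And>i. i \<in> A \<Longrightarrow> integrable M (\<lambda>w. (X i w)\<^sup>2)"
    and mean: "\<And>i. i \<in> A \<Longrightarrow> expectation (X i) = 0"
  shows "expectation (\<lambda>w. (\<Sum>i\<in>A. X i w)\<^sup>2) = (\<Sum>i\<in>A. expectation (\<lambda>w. (X i w)\<^sup>2))"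
proof -
  have cross: "integrable M (\<lambda>w. X i w * X j w) \<and>
      expectation (\<lambda>w. X i w * X j w) = (if i = j then expectation (\<lambda>w. (X i w)\<^sup>2) else 0)"
    if "i \<in> A" "j \<in> A" for i j
  proof (cases "i = j")
    case True
    then show ?thesis using int2[OF that(1)] by (simp add: power2_eq_square)
  next
    case False
    have ij: "indep_vars (\<lambda>_. borel) X {i, j}"
      using that by (intro indep_vars_subset[OF ind]) auto
    show ?thesis
      using indep_vars_integrable[OF _ ij] indep_vars_lebesgue_integral[OF _ ij] int mean that False
      by auto
  qed
  have "expectation (\<lambda>w. (\<Sum>i\<in>A. X i w)\<^sup>2) = expectation (\<lambda>w. \<Sum>i\<in>A. \<Sum>j\<in>A. X i w * X j w)"
    by (simp add: power2_eq_square sum_product)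
  also have "\<dots> = (\<Sum>i\<in>A. \<Sum>j\<in>A. expectation (\<lambda>w. X i w * X j w))"
    using cross by (simp add: Bochner_Integration.integral_sum)
  also have "\<dots> = (\<Sum>i\<in>A. \<Sum>j\<in>A. if i = j then expectation (\<lambda>w. (X i w)\<^sup>2) else 0)"
    using cross by (intro sum.cong refl) blast
  also have "\<dots> = (\<Sum>i\<in>A. expectation (\<lambda>w. (X i w)\<^sup>2))"
    using \<open>finite A\<close> by simp
  finally show ?thesis .
qed

section \<open>The binary entropy and its inverse\<close>

text \<open>Only the endpoint 0 is delicate: \<open>0 * ln 0 = 0\<close> agrees with the limit from
  the right.\<close>

lemma continuous_on_x_ln: "continuous_on {0..} (\<lambda>x::real. x * ln x)"
proof (unfold continuous_on_eq_continuous_within, intro ballI)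
  fix x :: real assume "x \<in> {0..}"
  show "continuous (at x within {0..}) (\<lambda>x. x * ln x)"
  proof (cases "x = 0")
    case True
    have "((\<lambda>x::real. x * ln x) \<longlongrightarrow> 0) (at_right 0)" by real_asymp
    then show ?thesis
      unfolding True continuous_within at_within_Ici_at_right by simp
  next
    case False
    then show ?thesis using \<open>x \<in> {0..}\<close> by (intro continuous_intros) auto
  qed
qed

lemma H2_eq_ln: "H2 p = - (p * ln p + (1 - p) * ln (1 - p)) / ln 2"
  by (simp add: H2_def log_def field_simps)

lemma continuous_on_H2: "continuous_on {0..1} H2"
proof -
  have "continuous_on {0..1::real} (\<lambda>p. p * ln p)"
    by (rule continuous_on_subset[OF continuous_on_x_ln]) auto
  moreover have "continuous_on {0..1::real} (\<lambda>p. (1 - p) * ln (1 - p))"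
    by (rule continuous_on_compose2[OF continuous_on_x_ln]) (auto intro!: continuous_intros)
  ultimately show ?thesis
    unfolding H2_eq_ln[abs_def]
    by (intro continuous_on_divide continuous_on_minus continuous_on_add) auto
qed

text \<open>The derivative \<open>log 2 ((1 - x) / x)\<close> is positive on the open interval;
  continuity takes care of the endpoint 0, where it blows up.\<close>

lemma H2_strict_mono:
  assumes "0 \<le> p" "p < q" "q \<le> 1/2"
  shows "H2 p < H2 q"
proof (rule DERIV_pos_imp_increasing_open[OF \<open>p < q\<close>])
  fix x assume x: "p < x" "x < q"
  have "DERIV H2 x :> (ln (1 - x) - ln x) / ln 2"
    unfolding H2_eq_ln[abs_def]
    by (rule derivative_eq_intros refl | use x assms in \<open>simp add: field_simps\<close>)+
  moreover have "(ln (1 - x) - ln x) / ln 2 > 0" using x assms by simp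
  ultimately show "\<exists>y. DERIV H2 x :> y \<and> y > 0" by blast
qed (rule continuous_on_subset[OF continuous_on_H2], use assms in auto)

lemma H2_mono: "0 \<le> p \<Longrightarrow> p \<le> q \<Longrightarrow> q \<le> 1/2 \<Longrightarrow> H2 p \<le> H2 q"
  using H2_strict_mono[of p q] by (cases "p = q") auto

lemma H2_symmetric: "H2 (1 - p) = H2 p"
  by (simp add: H2_def algebra_simps)

text \<open>\<open>H2 0 = 0\<close>, so the intermediate value theorem on \<open>[0, q]\<close> puts
  \<open>R\<close> in the image of \<open>[0, 1/2]\<close>, where \<open>H2\<close> is injective;
  there the chosen inverse is a true one.\<close>

lemma H2_H2_inv:
  assumes "0 \<le> R" "0 \<le> q" "q \<le> 1/2" "R \<le> H2 q"
  shows "0 \<le> H2_inv R" "H2_inv R \<le> 1/2" "H2 (H2_inv R) = R"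
proof -
  have "inj_on H2 {0..1/2}"
    by (intro linorder_inj_onI') (use H2_strict_mono in force)
  moreover have "continuous_on {0..q} H2"
    using assms by (intro continuous_on_subset[OF continuous_on_H2]) auto
  then have "\<exists>p\<ge>0. p \<le> q \<and> H2 p = R"
    by (intro IVT') (use assms in \<open>auto simp: H2_eq_ln\<close>)
  then have "R \<in> H2 ` {0..1/2}" using assms by force
  ultimately have "H2_inv R \<in> {0..1/2}" "H2 (H2_inv R) = R"
    unfolding H2_inv_def by (auto intro!: f_the_inv_into_f the_inv_into_into simp del: atLeastAtMost_iff)
  then show "0 \<le> H2_inv R" "H2_inv R \<le> 1/2" "H2 (H2_inv R) = R" by auto
qed

section \<open>One-bit mechanisms\<close>

text \<open>A Bernoulli law on the numbers 0 and 1, so that outputs enter linear estimators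
  directly.\<close>

definition bit_pmf :: "real \<Rightarrow> nat pmf" where
  "bit_pmf q = map_pmf of_bool (bernoulli_pmf q)"

lemma set_bit_pmf: "set_pmf (bit_pmf q) \<subseteq> {0, 1}"
  by (auto simp: bit_pmf_def)

lemma pmf_bit_pmf:
  assumes "0 \<le> q" "q \<le> 1"
  shows "pmf (bit_pmf q) (Suc 0) = q" "pmf (bit_pmf q) 0 = 1 - q"
proof -
  have inj: "inj (of_bool :: bool \<Rightarrow> nat)" by (auto simp: inj_on_def)
  show "pmf (bit_pmf q) (Suc 0) = q" "pmf (bit_pmf q) 0 = 1 - q"
    using pmf_map_inj'[OF inj, of "bernoulli_pmf q" True]
      pmf_map_inj'[OF inj, of "bernoulli_pmf q" False] assms
    by (simp_all add: bit_pmf_def)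
qed

lemma LDP_bit_pmf:
  assumes q: "\<And>x. 0 \<le> q x" "\<And>x. q x \<le> 1"
    and ratio1: "\<And>x x'. q x \<le> exp \<epsilon> * q x'"
    and ratio0: "\<And>x x'. 1 - q x \<le> exp \<epsilon> * (1 - q x')"
    and ent: "\<And>x. H2 (q x) \<le> R"
  shows "LDP \<epsilon> R {0, 1} (\<lambda>x. bit_pmf (q x))"
proof -
  have ratio: "ennreal u / ennreal v \<le> ennreal (exp \<epsilon>)"
    if "0 \<le> u" "0 \<le> v" "u \<le> exp \<epsilon> * v" for u v
  proof (cases "v = 0")
    \<comment> \<open>Here \<open>u = 0\<close> as well, and \<open>0 / 0 = 0\<close> in
      \<open>ennreal\<close>.\<close>
    case True
    then show ?thesis using that by (simp add: zero_le)
  next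
    case False
    then show ?thesis using that by (simp add: divide_ennreal ennreal_leI field_simps)
  qed
  have "cond_entropy_at {0, 1} (\<lambda>x. bit_pmf (q x)) x = H2 (q x)" for x
  proof -
    \<comment> \<open>This includes \<open>t = 0\<close>, where both sides are 0, so deterministic
      bits need no separate treatment.\<close>
    have "log 2 (1 / t) = - log 2 t" for t :: real
      by (simp add: log_def ln_div)
    then show ?thesis
      by (simp add: cond_entropy_at_def H2_def pmf_bit_pmf[OF q] algebra_simps)
  qed
  then show ?thesis
    unfolding LDP_def mechanism_def
    using set_bit_pmf ent
    by (auto intro!: SUP_least ratio simp: pmf_bit_pmf[OF q] q ratio1 ratio0)
qed

lemma bit_expectation:
  fixes f :: "nat \<Rightarrow> real"
  assumes "set_pmf D \<subseteq> {0, 1}" "pmf D (Suc 0) = \<mu>"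
  shows "measure_pmf.expectation D f = f 0 * (1 - \<mu>) + f 1 * \<mu>"
proof -
  have "sum (pmf D) {0, 1} = 1"
    using assms(1) by (intro sum_pmf_eq_1) auto
  then have "pmf D 0 = 1 - \<mu>" using assms(2) by simp
  then show ?thesis
    using assms by (subst integral_measure_pmf[of "{0, 1}"]) auto
qed

section \<open>Risk of the estimators\<close>

text \<open>Averaging over the independent inputs leaves the outputs independent, each with its
  mixture law; the variance computation relies on this product form.\<close>

lemma output_law_eq_Pi_pmf:
  "output_law n Q p = Pi_pmf {1..n} undefined (\<lambda>i. bind_pmf (simplex_pmf p) (Q i))"
  unfolding output_law_def by (rule Pi_pmf_bind[symmetric]) simp

lemma pmf_bind_simplex:
  fixes p :: "real ^ 'k::finite"
  assumes "p \<in> prob_simplex"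
  shows "pmf (bind_pmf (simplex_pmf p) Q) y = (\<Sum>x\<in>UNIV. p $ x * pmf (Q x) y)"
  unfolding pmf_bind
  by (subst integral_measure_pmf[of UNIV]) (auto simp: pmf_simplex_pmf[OF assms])

text \<open>Each coordinate of the error is a sum of \<open>m\<close> independent centred bits with
  weights of size \<open>1 / (m * b)\<close>, and each bit has variance at most \<open>1/4\<close>;
  summing over coordinates gives the factor \<open>CARD('k)\<close>.\<close>

lemma hadamard_estimator_risk:
  fixes a b :: real and m n :: nat and g :: "nat \<Rightarrow> 'k::finite \<Rightarrow> real" and p :: "real ^ 'k"
  defines "Q \<equiv> \<lambda>i x. bit_pmf (a + b * g i x)"
    and "est \<equiv> \<lambda>y. \<chi> x. (\<Sum>i\<in>{1..m}. g i x * (real (y i) - a)) / (real m * b)"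
  assumes b: "0 < b" "b \<le> a" "a + b \<le> 1" and m: "0 < m" "m \<le> n"
    and g: "\<And>i x. g i x \<in> {-1, 1}"
    and orth: "\<And>x x'. (\<Sum>i\<in>{1..m}. g i x * g i x') = (if x = x' then real m else 0)"
    and p: "p \<in> prob_simplex"
  shows "l2_risk n Q est p \<le> ennreal (CARD('k) / (4 * m * b\<^sup>2))"
proof -
  define \<mu> where "\<mu> i = a + b * (\<Sum>x\<in>UNIV. g i x * p $ x)" for i
  define D where "D i = bind_pmf (simplex_pmf p) (Q i)" for i
  define P where "P = Pi_pmf {1..n} undefined D"
  have D: "set_pmf (D i) \<subseteq> {0, 1}" for i
    using set_bit_pmf by (auto simp: D_def Q_def)
  have rate: "0 \<le> a + b * g i x" "a + b * g i x \<le> 1" for i x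
    using g[of i x] b by auto
  have D1: "pmf (D i) (Suc 0) = \<mu> i" for i
  proof -
    have "pmf (D i) (Suc 0) = (\<Sum>x\<in>UNIV. a * p $ x + b * (g i x * p $ x))"
      unfolding D_def pmf_bind_simplex[OF p]
      by (intro sum.cong refl) (simp add: Q_def pmf_bit_pmf[OF rate] algebra_simps)
    also have "\<dots> = \<mu> i"
      using p by (simp add: sum.distrib sum_distrib_left[symmetric] \<mu>_def prob_simplex_def)
    finally show ?thesis .
  qed
  have mean: "measure_pmf.expectation (D i) (\<lambda>v. real v - \<mu> i) = 0"
    and var: "measure_pmf.expectation (D i) (\<lambda>v. (real v - \<mu> i)\<^sup>2) \<le> 1/4" for i
  proof -
    show "measure_pmf.expectation (D i) (\<lambda>v. real v - \<mu> i) = 0"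
      by (subst bit_expectation[OF D D1]) (simp add: algebra_simps)
    \<comment> \<open>The variance \<open>\<mu> i * (1 - \<mu> i)\<close> with the square
      completed.\<close>
    have "measure_pmf.expectation (D i) (\<lambda>v. (real v - \<mu> i)\<^sup>2) = 1/4 - (\<mu> i - 1/2)\<^sup>2"
      by (subst bit_expectation[OF D D1]) (simp add: power2_eq_square algebra_simps)
    then show "measure_pmf.expectation (D i) (\<lambda>v. (real v - \<mu> i)\<^sup>2) \<le> 1/4" by simp
  qed
  have fin: "finite (set_pmf P)"
    unfolding P_def
    by (rule finite_subset[OF set_Pi_pmf_subset'])
       (auto intro!: finite_PiE_dflt finite_subset[OF D])
  have int: "integrable (measure_pmf P) f" for f :: "(nat \<Rightarrow> nat) \<Rightarrow> real"
    by (rule integrable_measure_pmf_finite[OF fin])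
  have comp: "measure_pmf.expectation P (\<lambda>y. f (y i)) = measure_pmf.expectation (D i) f"
    if "i \<in> {1..m}" for i and f :: "nat \<Rightarrow> real"
  proof -
    have "map_pmf (\<lambda>y. y i) P = D i"
      using that m by (simp add: P_def Pi_pmf_component)
    then show ?thesis by (metis integral_map_pmf)
  qed
  have err: "est y $ x - p $ x = (\<Sum>i\<in>{1..m}. g i x * (real (y i) - \<mu> i)) / (real m * b)"
    for y x
  proof -
    \<comment> \<open>Pairing the centred means with column \<open>x\<close> isolates
      \<open>p $ x\<close> by orthogonality; this is unbiasedness.\<close>
    have "(\<Sum>i\<in>{1..m}. g i x * (\<mu> i - a)) = (\<Sum>i\<in>{1..m}. \<Sum>x'\<in>UNIV. b * p $ x' * (g i x * g i x'))"
      by (simp add: \<mu>_def sum_distrib_left mult_ac)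
    also have "\<dots> = (\<Sum>x'\<in>UNIV. b * p $ x' * (\<Sum>i\<in>{1..m}. g i x * g i x'))"
      by (subst sum.swap) (simp add: sum_distrib_left)
    also have "\<dots> = (\<Sum>x'\<in>UNIV. if x = x' then b * p $ x' * real m else 0)"
      unfolding orth by (intro sum.cong) auto
    also have "\<dots> = real m * b * p $ x" by simp
    finally have "p $ x = (\<Sum>i\<in>{1..m}. g i x * (\<mu> i - a)) / (real m * b)"
      using b m by simp
    then show ?thesis
      by (simp add: est_def diff_divide_distrib[symmetric] sum_subtractf[symmetric]
          right_diff_distrib[symmetric])
  qed
  have coord: "measure_pmf.expectation P (\<lambda>y. (est y $ x - p $ x)\<^sup>2) \<le> 1 / (4 * m * b\<^sup>2)" for x
  proof -
    have g2: "(g i x)\<^sup>2 = 1" for i using g[of i x] by auto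
    have "prob_space.indep_vars (measure_pmf P) (\<lambda>_. count_space UNIV) (\<lambda>i y. y i) {1..m}"
      unfolding P_def
      by (rule prob_space.indep_vars_subset[OF measure_pmf.prob_space_axioms indep_vars_Pi_pmf]) (use m in auto)
    then have "prob_space.indep_vars (measure_pmf P) (\<lambda>_. borel)
        (\<lambda>i y. g i x * (real (y i) - \<mu> i)) {1..m}"
      by (rule prob_space.indep_vars_compose2[OF measure_pmf.prob_space_axioms]) auto
    then have "measure_pmf.expectation P (\<lambda>y. (\<Sum>i\<in>{1..m}. g i x * (real (y i) - \<mu> i))\<^sup>2)
        = (\<Sum>i\<in>{1..m}. measure_pmf.expectation P (\<lambda>y. (g i x * (real (y i) - \<mu> i))\<^sup>2))"
    proof (rule prob_space.second_moment_indep_sum[OF measure_pmf.prob_space_axioms, rotated])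
      show "measure_pmf.expectation P (\<lambda>y. g i x * (real (y i) - \<mu> i)) = 0"
        if "i \<in> {1..m}" for i
        using comp[OF that, of "\<lambda>v. g i x * (real v - \<mu> i)"] mean[of i] by simp
    qed (use int in auto)
    also have "\<dots> \<le> (\<Sum>i\<in>{1..m}. 1/4)"
    proof (intro sum_mono)
      fix i assume "i \<in> {1..m}"
      then show "measure_pmf.expectation P (\<lambda>y. (g i x * (real (y i) - \<mu> i))\<^sup>2) \<le> 1/4"
        using comp[of i "\<lambda>v. (real v - \<mu> i)\<^sup>2"] var[of i] by (simp add: power_mult_distrib g2)
    qed
    finally have "measure_pmf.expectation P (\<lambda>y. (\<Sum>i\<in>{1..m}. g i x * (real (y i) - \<mu> i))\<^sup>2)
        \<le> real m / 4" by simp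
    then have "measure_pmf.expectation P (\<lambda>y. (\<Sum>i\<in>{1..m}. g i x * (real (y i) - \<mu> i))\<^sup>2)
        / (real m * b)\<^sup>2 \<le> (real m / 4) / (real m * b)\<^sup>2"
      by (rule divide_right_mono) simp
    then have "measure_pmf.expectation P (\<lambda>y. (est y $ x - p $ x)\<^sup>2) \<le> (real m / 4) / (real m * b)\<^sup>2"
      by (simp add: err power_divide)
    also have "\<dots> = 1 / (4 * m * b\<^sup>2)"
      using b m by (simp add: power2_eq_square)
    finally show ?thesis .
  qed
  have "l2_risk n Q est p = ennreal (measure_pmf.expectation P (\<lambda>y. (norm (est y - p))\<^sup>2))"
    unfolding l2_risk_def output_law_eq_Pi_pmf D_def[symmetric] P_def[symmetric]
    by (rule nn_integral_eq_integral[OF int]) simp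
  also have "measure_pmf.expectation P (\<lambda>y. (norm (est y - p))\<^sup>2)
      = (\<Sum>x\<in>UNIV. measure_pmf.expectation P (\<lambda>y. (est y $ x - p $ x)\<^sup>2))"
    unfolding norm_vec_def L2_set_def
    by (simp add: sum_nonneg Bochner_Integration.integral_sum int)
  also have "\<dots> \<le> (\<Sum>x\<in>(UNIV :: 'k set). 1 / (4 * m * b\<^sup>2))"
    by (intro sum_mono coord)
  also have "\<dots> = CARD('k) / (4 * m * b\<^sup>2)" by simp
  finally show ?thesis by (simp add: ennreal_leI)
qed

text \<open>Coordinates of \<open>p\<close> lie in \<open>[0, 1]\<close>, so their squares sum to at
  most 1.\<close>

lemma zero_estimator_risk:
  fixes p :: "real ^ 'k::finite"
  assumes "p \<in> prob_simplex"
  shows "l2_risk n Q (\<lambda>_. 0) p \<le> 1"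
proof -
  have "(norm p)\<^sup>2 = (\<Sum>x\<in>UNIV. (p $ x)\<^sup>2)"
    by (simp add: norm_vec_def L2_set_def sum_nonneg)
  also have "\<dots> \<le> (\<Sum>x\<in>UNIV. p $ x)"
  proof (intro sum_mono)
    fix x
    have "p $ x \<le> (\<Sum>x\<in>UNIV. p $ x)"
      using assms by (intro member_le_sum) (auto simp: prob_simplex_def)
    then show "(p $ x)\<^sup>2 \<le> p $ x"
      using assms by (auto simp: prob_simplex_def power2_eq_square intro: mult_left_le)
  qed
  finally have "(norm p)\<^sup>2 \<le> 1" using assms by (simp add: prob_simplex_def)
  then show ?thesis by (simp add: l2_risk_def)
qed

text \<open>Cauchy-Schwarz twice: over the coordinates, which yields the factor
  \<open>CARD('k)\<close>, and over the expectation.\<close>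

lemma l1_risk_power2_le:
  "(l1_risk n Q est p)\<^sup>2 \<le> of_nat CARD('k::finite) * l2_risk n Q est (p :: real ^ 'k)"
proof -
  let ?M = "measure_pmf (output_law n Q p)"
  have "(l1_norm v)\<^sup>2 \<le> real CARD('k) * (norm v)\<^sup>2" for v :: "real ^ 'k"
    using sum_squared_le_sum_of_squares[of "\<lambda>x. \<bar>v $ x\<bar>" "UNIV :: 'k set"]
    by (simp add: l1_norm_def norm_vec_def L2_set_def sum_nonneg mult.commute)
  then have *: "(ennreal (l1_norm v))\<^sup>2 \<le> of_nat CARD('k) * ennreal ((norm v)\<^sup>2)" for v :: "real ^ 'k"
    by (simp add: ennreal_power l1_norm_def sum_nonneg ennreal_of_nat_eq_real_of_nat
        ennreal_leI flip: ennreal_mult)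
  have "(l1_risk n Q est p)\<^sup>2 \<le> (\<integral>\<^sup>+y. (ennreal (l1_norm (est y - p)))\<^sup>2 \<partial>?M)"
    using Cauchy_Schwarz_nn_integral[of "\<lambda>y. ennreal (l1_norm (est y - p))" ?M "\<lambda>_. 1"]
    by (simp add: l1_risk_def)
  also have "\<dots> \<le> (\<integral>\<^sup>+y. of_nat CARD('k) * ennreal ((norm (est y - p))\<^sup>2) \<partial>?M)"
    by (intro nn_integral_mono *)
  also have "\<dots> = of_nat CARD('k) * l2_risk n Q est p"
    by (simp add: l2_risk_def nn_integral_cmult)
  finally show ?thesis .
qed

lemma le_ennreal_sqrtI:
  assumes "x\<^sup>2 \<le> y"
  shows "x \<le> ennreal_sqrt y"
proof (cases "y = \<infinity>")
  case False
  then obtain v where v: "y = ennreal v" "0 \<le> v" by (cases y) auto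
  with assms have "x \<noteq> \<infinity>" by (auto simp: top_unique)
  then obtain u where "x = ennreal u" "0 \<le> u" by (cases x) auto
  then show ?thesis
    using assms v by (simp add: ennreal_sqrt_def ennreal_power ennreal_leI real_le_rsqrt)
qed (simp add: ennreal_sqrt_def)

section \<open>The one-bit scheme and its parameters\<close>

lemma one_bit_scheme:
  fixes a b \<epsilon> R :: real and n :: nat
  assumes "0 \<le> \<epsilon>" and b: "0 \<le> b" "b \<le> a" "a + b \<le> 1"
    and ratio1: "a + b \<le> exp \<epsilon> * (a - b)" and ratio0: "1 - (a - b) \<le> exp \<epsilon> * (1 - (a + b))"
    and ent: "H2 (a + b) \<le> R" "H2 (a - b) \<le> R"
  shows "\<exists>(Y :: nat set) (Q :: nat \<Rightarrow> 'k::finite \<Rightarrow> nat pmf) (est :: (nat \<Rightarrow> nat) \<Rightarrow> real ^ 'k).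
           (\<forall>i\<in>{1..n}. LDP \<epsilon> R Y (Q i)) \<and>
           (\<forall>p\<in>prob_simplex. l2_risk n Q est p
              \<le> ennreal (2 * real CARD('k)) / ennreal (real n * (2 * b)\<^sup>2))"
proof -
  let ?Q = "\<lambda>g i (x::'k). bit_pmf (a + b * g i x)"
  have exp1: "1 \<le> exp \<epsilon>" using assms(1) by simp
  have LDP: "LDP \<epsilon> R {0, 1} (?Q g i)" if g: "\<And>i x. g i x \<in> {-1, 1}" for g :: "nat \<Rightarrow> 'k \<Rightarrow> real" and i
  proof (rule LDP_bit_pmf)
    have le: "u \<le> exp \<epsilon> * v" if "u \<le> v" "0 \<le> v" for u v
      using that mult_right_mono[OF exp1, of v] by linarith
    show "0 \<le> a + b * g i x" "a + b * g i x \<le> 1" "H2 (a + b * g i x) \<le> R" for x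
      using g[of i x] b ent by auto
    show "a + b * g i x \<le> exp \<epsilon> * (a + b * g i x')"
      "1 - (a + b * g i x) \<le> exp \<epsilon> * (1 - (a + b * g i x'))" for x x'
      using g[of i x] g[of i x'] ratio1 ratio0 b by (auto intro: le)
  qed
  show ?thesis
  proof (cases "n < 2 * CARD('k) \<or> b = 0")
    case True
    \<comment> \<open>Either the denominator is 0 and the quotient infinite, or
      \<open>2 * b \<le> 1\<close> (from \<open>b \<le> a\<close> and \<open>a + b \<le> 1\<close>)
      and \<open>n < 2 * CARD('k)\<close>.\<close>
    have "1 \<le> ennreal (2 * real CARD('k)) / ennreal (real n * (2 * b)\<^sup>2)"
    proof (cases "real n * (2 * b)\<^sup>2 = 0")
      case zero: True
      show ?thesis unfolding zero by simp
    next
      case False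
      have "(2 * b)\<^sup>2 \<le> 1" using b by (intro power_le_one) auto
      then have "real n * (2 * b)\<^sup>2 \<le> real n" by (simp add: mult_left_le)
      also have "\<dots> \<le> 2 * real CARD('k)" using True False by auto
      finally have le: "real n * (2 * b)\<^sup>2 \<le> 2 * real CARD('k)" .
      have "0 < real n * (2 * b)\<^sup>2" using False by (simp add: zero_less_mult_iff)
      then show ?thesis using le by (subst divide_ennreal) (auto simp: le_divide_eq)
    qed
    \<comment> \<open>The estimator ignores the outputs, so any admissible mechanism will do; all
      signs are set to 1.\<close>
    then have "\<forall>p\<in>prob_simplex. l2_risk n (?Q (\<lambda>_ _. 1)) (\<lambda>_. 0) p
        \<le> ennreal (2 * real CARD('k)) / ennreal (real n * (2 * b)\<^sup>2)"
      by (intro ballI order_trans[OF zero_estimator_risk])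
    moreover have "\<forall>i\<in>{1..n}. LDP \<epsilon> R {0, 1} (?Q (\<lambda>_ _. 1) i)"
      by (intro ballI LDP) simp
    ultimately show ?thesis
      by (intro exI[of _ "{0, 1}"] exI[of _ "?Q (\<lambda>_ _. 1)"] exI[of _ "\<lambda>_. 0"] conjI)
  next
    case False
    then have "2 * CARD('k) \<le> n" and "0 < b" using b by auto
    obtain m and g :: "nat \<Rightarrow> 'k \<Rightarrow> real" where m: "0 < m" "m \<le> n" "n \<le> 2 * m"
      and g: "\<And>i x. g i x \<in> {-1, 1}"
      and orth: "\<And>x x'. (\<Sum>i\<in>{1..m}. g i x * g i x') = (if x = x' then real m else 0)"
      by (rule orthogonal_sign_design[OF \<open>2 * CARD('k) \<le> n\<close>]) (rule that)
    have "CARD('k) / (4 * m * b\<^sup>2) \<le> 2 * real CARD('k) / (real n * (2 * b)\<^sup>2)"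
    proof -
      \<comment> \<open>Rewritten with \<open>2 * m\<close>, which is at least \<open>n\<close>:
        discarding users costs a factor of at most 2.\<close>
      have "CARD('k) / (4 * m * b\<^sup>2) = 2 * real CARD('k) / (real (2 * m) * (2 * b)\<^sup>2)"
        by (simp add: power2_eq_square)
      also have "\<dots> \<le> 2 * real CARD('k) / (real n * (2 * b)\<^sup>2)"
        using m \<open>0 < b\<close> by (intro divide_left_mono mult_right_mono mult_pos_pos) auto
      finally show ?thesis .
    qed
    then have "ennreal (CARD('k) / (4 * m * b\<^sup>2))
        \<le> ennreal (2 * real CARD('k)) / ennreal (real n * (2 * b)\<^sup>2)"
      using m \<open>0 < b\<close> by (subst divide_ennreal) (auto intro: ennreal_leI)
    then have "\<forall>p\<in>prob_simplex. l2_risk n (?Q g)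
        (\<lambda>y. \<chi> x. (\<Sum>i\<in>{1..m}. g i x * (real (y i) - a)) / (real m * b)) p
        \<le> ennreal (2 * real CARD('k)) / ennreal (real n * (2 * b)\<^sup>2)"
      by (intro ballI order_trans[OF hadamard_estimator_risk[OF \<open>0 < b\<close> b(2,3) m(1,2) g orth]])
    moreover have "\<forall>i\<in>{1..n}. LDP \<epsilon> R {0, 1} (?Q g i)" by (intro ballI LDP g)
    ultimately show ?thesis
      by (intro exI[of _ "{0, 1}"] exI[of _ "?Q g"] exI conjI)
  qed
qed

text \<open>For \<open>v = 0\<close> both quotients are infinite or both are 0, according to
  \<open>u\<close>. Hence the degenerate values of \<open>eta\<close> follow the same computation as
  the others.\<close>

lemma ennreal_divide_cancel:
  assumes "0 < c" "0 \<le> u" "0 \<le> v"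
  shows "ennreal (c * u) / ennreal (c * v) = ennreal u / ennreal v"
proof (cases "v = 0")
  case True
  then show ?thesis using assms
    by (cases "u = 0") (auto simp: ennreal_divide_zero)
next
  case False
  then show ?thesis using assms by (simp add: divide_ennreal)
qed

theorem theorem2:
  fixes \<epsilon> R :: real and n :: nat
  assumes "0 \<le> \<epsilon>" and "0 \<le> R"
  shows "\<exists>(Y :: nat set) (Q :: nat \<Rightarrow> 'k::finite \<Rightarrow> nat pmf) (est :: (nat \<Rightarrow> nat) \<Rightarrow> real ^ 'k).
           (\<forall>i\<in>{1..n}. LDP \<epsilon> R Y (Q i)) \<and>
           (SUP p\<in>prob_simplex. l2_risk n Q est p) \<le> eta \<epsilon> R CARD('k) n \<and>
           (SUP p\<in>prob_simplex. l1_risk n Q est p)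
             \<le> ennreal_sqrt (of_nat CARD('k) * eta \<epsilon> R CARD('k) n)"
proof -
  define E where "E = exp \<epsilon>"
  have E: "1 \<le> E" using assms(1) by (simp add: E_def)
  have "\<exists>(Y :: nat set) (Q :: nat \<Rightarrow> 'k::finite \<Rightarrow> nat pmf) (est :: (nat \<Rightarrow> nat) \<Rightarrow> real ^ 'k).
           (\<forall>i\<in>{1..n}. LDP \<epsilon> R Y (Q i)) \<and>
           (\<forall>p\<in>prob_simplex. l2_risk n Q est p \<le> eta \<epsilon> R CARD('k) n)"
  proof (cases "H2 (E / (E + 1)) \<le> R")
    case True
    \<comment> \<open>Solves \<open>1/2 + b = E / (E + 1)\<close>. The two probabilities are
      complementary, so by symmetry of \<open>H2\<close> they have equal entropy.\<close>
    define b where "b = (E - 1) / (2 * (E + 1))"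
    have pm: "1/2 + b = E / (E + 1)" "1/2 - b = 1 / (E + 1)"
      using E by (simp_all add: b_def field_simps)
    have sum1: "1 / (E + 1) = 1 - E / (E + 1)" using E by (simp add: field_simps)
    have "eta \<epsilon> R CARD('k) n
        = ennreal ((E + 1)\<^sup>2 * (2 * real CARD('k))) / ennreal ((E + 1)\<^sup>2 * (real n * (2 * b)\<^sup>2))"
    proof -
      have "(E + 1) * (2 * b) = E - 1" using E by (simp add: b_def field_simps)
      then have "(E + 1)\<^sup>2 * (2 * b)\<^sup>2 = (E - 1)\<^sup>2" by (metis power_mult_distrib)
      then have "(E + 1)\<^sup>2 * (real n * (2 * b)\<^sup>2) = real n * (E - 1)\<^sup>2"
        by (metis mult.left_commute)
      moreover have "eta \<epsilon> R CARD('k) n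
          = ennreal ((E + 1)\<^sup>2 * (2 * real CARD('k))) / ennreal (real n * (E - 1)\<^sup>2)"
        using True by (simp add: eta_def E_def mult_ac)
      ultimately show ?thesis by (simp only:)
    qed
    also have "\<dots> = ennreal (2 * real CARD('k)) / ennreal (real n * (2 * b)\<^sup>2)"
      using E by (intro ennreal_divide_cancel) auto
    finally have eta: "eta \<epsilon> R CARD('k) n = \<dots>" .
    have "0 \<le> b" "b \<le> 1/2" using E by (auto simp: b_def field_simps)
    then show ?thesis
      unfolding eta using E True assms
      by (intro one_bit_scheme[where a = "1/2"])
         (auto simp: pm sum1 H2_symmetric simp flip: E_def, auto simp: field_simps)
  next
    case False
    define q where "q = H2_inv R"
    \<comment> \<open>\<open>E / (E + 1)\<close> is at least \<open>1/2\<close>; its mirror image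
      \<open>1 / (E + 1)\<close> lies in the range where \<open>H2\<close> is inverted.\<close>
    have "1 / (E + 1) = 1 - E / (E + 1)" using E by (simp add: field_simps)
    then have "H2 (1 / (E + 1)) = H2 (E / (E + 1))" using H2_symmetric by metis
    then have q: "0 \<le> q" "q \<le> 1/2" "H2 q = R"
      unfolding q_def
      using H2_H2_inv[of R "1 / (E + 1)"] False assms(2) E by (auto simp: field_simps)
    \<comment> \<open>\<open>a\<close> and \<open>b\<close> solve \<open>a + b = q\<close> and
      \<open>a - b = q / E\<close>, making the likelihood ratio of the output 1 tight.\<close>
    define a where "a = q * (1 + 1 / E) / 2"
    define b where "b = q * (1 - 1 / E) / 2"
    have pm: "a + b = q" "a - b = q / E"
      using E by (simp_all add: a_def b_def field_simps)
    have b0: "0 \<le> b" "b \<le> a"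
      using E q mult_right_mono[OF E q(1)] by (auto simp: a_def b_def field_simps)
    have qE: "0 \<le> q / E" "q / E \<le> q"
      using E q mult_right_mono[OF E q(1)] by (auto simp: field_simps)
    \<comment> \<open>The difference of the two sides is
      \<open>(E - 1) * (E - q * (E + 1)) / E\<close>, nonnegative because \<open>q \<le> 1/2\<close>
      and \<open>E \<ge> 1\<close>.\<close>
    have ratio0: "1 - q / E \<le> E * (1 - q)"
    proof -
      have "q * (E + 1) \<le> 1/2 * (E + 1)" using E q by (intro mult_right_mono) auto
      also have "\<dots> \<le> E" using E by simp
      finally have "q * (E + 1) \<le> E" .
      then have "0 \<le> (E - 1) * (E - q * (E + 1))"
        using E by (intro mult_nonneg_nonneg) linarith+
      then show ?thesis using E by (simp add: field_simps)
    qed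
    have "eta \<epsilon> R CARD('k) n
        = ennreal (E\<^sup>2 * (2 * real CARD('k))) / ennreal (E\<^sup>2 * (real n * (2 * b)\<^sup>2))"
    proof -
      have "E * (2 * b) = q * (E - 1)" using E by (simp add: b_def field_simps)
      then have "E\<^sup>2 * (2 * b)\<^sup>2 = q\<^sup>2 * (E - 1)\<^sup>2" by (metis power_mult_distrib)
      then have "E\<^sup>2 * (real n * (2 * b)\<^sup>2) = real n * q\<^sup>2 * (E - 1)\<^sup>2"
        by (metis mult.left_commute mult.assoc)
      moreover have "exp (2 * \<epsilon>) = E\<^sup>2" by (simp add: E_def exp_double)
      then have "eta \<epsilon> R CARD('k) n
          = ennreal (E\<^sup>2 * (2 * real CARD('k))) / ennreal (real n * q\<^sup>2 * (E - 1)\<^sup>2)"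
        using False by (simp add: eta_def E_def q_def mult_ac)
      ultimately show ?thesis by (simp only:)
    qed
    also have "\<dots> = ennreal (2 * real CARD('k)) / ennreal (real n * (2 * b)\<^sup>2)"
      using E by (intro ennreal_divide_cancel) auto
    finally have eta: "eta \<epsilon> R CARD('k) n = \<dots>" .
    have "H2 (q / E) \<le> R" using H2_mono[OF qE q(2)] q(3) by simp
    then show ?thesis
      unfolding eta using E assms q b0 ratio0
      by (intro one_bit_scheme[where a = a]) (auto simp: pm simp flip: E_def)
  qed
  then obtain Y and Q :: "nat \<Rightarrow> 'k \<Rightarrow> nat pmf" and est :: "(nat \<Rightarrow> nat) \<Rightarrow> real ^ 'k"
    where LDP: "\<forall>i\<in>{1..n}. LDP \<epsilon> R Y (Q i)"
      and l2: "\<forall>p\<in>prob_simplex. l2_risk n Q est p \<le> eta \<epsilon> R CARD('k) n"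
    by blast
  have "l1_risk n Q est p \<le> ennreal_sqrt (of_nat CARD('k) * eta \<epsilon> R CARD('k) n)"
    if "p \<in> prob_simplex" for p
    using l2 that
    by (intro le_ennreal_sqrtI order_trans[OF l1_risk_power2_le] mult_left_mono) auto
  then show ?thesis
    using LDP l2 by (intro exI[of _ Y] exI[of _ Q] exI[of _ est]) (auto intro!: SUP_least)
qed

end
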